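(* Let $N\ge1$ and let $W$ be an $N\times N$-mode fermionic state that is invariant under the fermionic unitary operations $U\wedge U$, i.e. $(U\wedge U)W(U^\dagger\wedge U^\dagger)=W$ for every unitary $U$ on $N$ modes that is block-diagonal or anti-block-diagonal. Then there are scalars $a^E,a^O,b^E,b^O$ such that $$W=a^E\,\mathbb I^{|E\rangle\langle E|}+a^O\,\mathbb I^{|O\rangle\langle O|}+b^E\,H_N^{|E\rangle\langle E|}+b^O\,H_N^{|O\rangle\langle O|}.$$
   Context: Fermionic setting. An $N$-mode fermionic system has the $d=2^N$ dimensional Fock space with orthonormal occupation-number basis $f_{j_1}^\dagger\cdots f_{j_k}^\dagger|\Omega\rangle$ ($j_1<\dots<j_k$). The basis vectors with $k$ even are denoted $|E_1\rangle,\dots,|E_{d/2}\rangle$ and those with $k$ odd $|O_1\rangle,\dots,|O_{d/2}\rangle$. An operator is block-diagonal (BD) if it lies in the span of the $|E_i\rangle\langle E_j|$, $|O_i\rangle\langle O_j|$, and anti-block-diagonal (ABD) if it lies in the span of the $|E_i\rangle\langle O_j|$, $|O_i\rangle\langle E_j|$. For a bipartite system $AB$ of $N+N$ modes, the vectors $|x\rangle\wedge|y\rangle$ (where $|x\rangle$ ranges over the basis $\{|E_1\rangle,\dots,|E_{d/2}\rangle,|O_1\rangle,\dots,|O_{d/2}\rangle\}$ of $A$ and $|y\rangle$ over the corresponding basis of $B$; creation operators of $A$ to the left of those of $B$, applied to the vacuum) form an orthonormal basis; $\langle x|\wedge\langle y|$ is the bra dual to $|x\rangle\wedge|y\rangle$;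 and the wedge product of operators is the bilinear extension of $|x\rangle\langle x'|\wedge|y\rangle\langle y'|=(|x\rangle\wedge|y\rangle)(\langle x'|\wedge\langle y'|)$. A fermionic state is a density operator commuting with total fermion parity (parity superselection rule). Operators on $N\times N$ modes: $\mathbb I^{|E\rangle\langle E|}=\sum_{ij}(|E_i\rangle\langle E_i|\wedge|E_j\rangle\langle E_j|+|O_i\rangle\langle O_i|\wedge|O_j\rangle\langle O_j|)$, $\mathbb I^{|O\rangle\langle O|}=\sum_{ij}(|E_i\rangle\langle E_i|\wedge|O_j\rangle\langle O_j|+|O_i\rangle\langle O_i|\wedge|E_j\rangle\langle E_j|)$, $H_N^{|E\rangle\langle E|}=\sum_{ij}(|E_i\rangle\langle E_j|\wedge|E_j\rangle\langle E_i|+|O_i\rangle\langle O_j|\wedge|O_j\rangle\langle O_i|)$, $H_N^{|O\rangle\langle O|}=\sum_{ij}(|E_i\rangle\langle O_j|\wedge|O_j\rangle\langle E_i|+|O_i\rangle\langle E_j|\wedge|E_j\rangle\langle O_i|)$. *)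

theory Defs
  imports "HOL-Analysis.Analysis"
begin

section \<open>Mode order of a composite system\<close>

text \<open>The modes of a composite system form a sum type. All modes of the left factor precede all
  modes of the right factor.\<close>

instantiation sum :: (linorder, linorder) linorder
begin

definition less_eq_sum :: "'a + 'b \<Rightarrow> 'a + 'b \<Rightarrow> bool" where
  "less_eq_sum s t = (case (s, t) of
      (Inl a, Inl a') \<Rightarrow> a \<le> a'
    | (Inl a, Inr b') \<Rightarrow> True
    | (Inr b, Inl a') \<Rightarrow> False
    | (Inr b, Inr b') \<Rightarrow> b \<le> b')"

definition less_sum :: "'a + 'b \<Rightarrow> 'a + 'b \<Rightarrow> bool" where
  "less_sum s t = (s \<le> t \<and> \<not> t \<le> s)"

instance
  by standard (auto simp: less_eq_sum_def less_sum_def split: sum.splits)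

end

lemma sum_order_simps [simp]:
  "Inl a \<le> Inl a' \<longleftrightarrow> a \<le> a'" "Inl a \<le> Inr b'" "\<not> Inr b \<le> Inl a'" "Inr b \<le> Inr b' \<longleftrightarrow> b \<le> b'"
  "Inl a < Inl a' \<longleftrightarrow> a < a'" "Inl a < Inr b'" "\<not> Inr b < Inl a'" "Inr b < Inr b' \<longleftrightarrow> b < b'"
  for a a' :: "'a::linorder" and b b' :: "'b::linorder"
  by (auto simp: less_eq_sum_def less_sum_def)


section \<open>Complex matrices\<close>

text \<open>The scalar multiplications of the library on matrices are by reals (\<open>*\<^sub>R\<close>) or act on vectors
  only (\<open>*s\<close>). The complex span of a set of operators needs this one.\<close>

definition cscale :: "complex \<Rightarrow> complex^'a^'b \<Rightarrow> complex^'a^'b" (infixr "*\<^sub>C" 75) where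
  "c *\<^sub>C A = (\<chi> i j. c * A $ i $ j)"

global_interpretation cmat: vector_space "cscale :: complex \<Rightarrow> complex^'a^'b \<Rightarrow> complex^'a^'b"
  by standard (simp_all add: cscale_def vec_eq_iff algebra_simps)

definition dagger :: "complex^'a^'b \<Rightarrow> complex^'b^'a" where
  "dagger A = (\<chi> i j. cnj (A $ j $ i))"

text \<open>Conjugate-linear in the first argument.\<close>

definition braket :: "complex^'a \<Rightarrow> complex^'a \<Rightarrow> complex" where
  "braket v w = (\<Sum>i\<in>UNIV. cnj (v $ i) * w $ i)"

text \<open>The rank-one operator $|v\rangle\langle w|$.\<close>

definition ketbra :: "complex^'b \<Rightarrow> complex^'a \<Rightarrow> complex^'a^'b" where
  "ketbra v w = (\<chi> i j. v $ i * cnj (w $ j))"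

definition unitary :: "complex^'a^'a \<Rightarrow> bool" where
  "unitary U \<longleftrightarrow> dagger U ** U = mat 1 \<and> U ** dagger U = mat 1"

definition density_operator :: "complex^'a^'a \<Rightarrow> bool" where
  "density_operator W \<longleftrightarrow>
     dagger W = W \<and> (\<forall>v. 0 \<le> Re (braket v (W *v v))) \<and> trace W = 1"


section \<open>Fermionic Fock space\<close>

text \<open>The modes are the elements of a finite linear order \<open>'m\<close>. A vector is given by its amplitudes
  on the sets of occupied modes, so that the dimension is \<open>2 ^ CARD('m)\<close>.\<close>

type_synonym 'm fock = "complex^('m set)"
type_synonym 'm fock_op = "complex^('m set)^('m set)"

definition vacuum :: "'m::{finite,linorder} fock" where
  "vacuum = axis {} 1"

definition creation :: "'m::{finite,linorder} \<Rightarrow> 'm fock_op" where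
  "creation j = (\<chi> S T. if j \<notin> T \<and> S = insert j T then (-1) ^ card {i \<in> T. i < j} else 0)"

text \<open>\<open>create_all [j\<^sub>1, \<dots>, j\<^sub>k]\<close> is $f_{j_1}^\dagger\cdots f_{j_k}^\dagger|\Omega\rangle$.\<close>

definition create_all :: "'m::{finite,linorder} list \<Rightarrow> 'm fock" where
  "create_all js = foldr (\<lambda>j v. creation j *v v) js vacuum"

definition ket :: "'m::{finite,linorder} set \<Rightarrow> 'm fock" where
  "ket S = create_all (sorted_list_of_set S)"

text \<open>The kets $|E_i\rangle$ are \<open>ket S\<close> for \<open>S \<in> Ev\<close>; the kets $|O_i\rangle$ are \<open>ket S\<close> for
  \<open>S \<in> Od\<close>.\<close>

definition Ev :: "'m set set" where
  "Ev = {S. even (card S)}"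

definition Od :: "'m set set" where
  "Od = {S. odd (card S)}"

definition block_diagonal :: "'m::{finite,linorder} fock_op \<Rightarrow> bool" where
  "block_diagonal A \<longleftrightarrow> A \<in> cmat.span
     ({ketbra (ket S) (ket T) |S T. S \<in> Ev \<and> T \<in> Ev} \<union>
      {ketbra (ket S) (ket T) |S T. S \<in> Od \<and> T \<in> Od})"

definition anti_block_diagonal :: "'m::{finite,linorder} fock_op \<Rightarrow> bool" where
  "anti_block_diagonal A \<longleftrightarrow> A \<in> cmat.span
     ({ketbra (ket S) (ket T) |S T. S \<in> Ev \<and> T \<in> Od} \<union>
      {ketbra (ket S) (ket T) |S T. S \<in> Od \<and> T \<in> Ev})"

definition parity :: "'m::{finite,linorder} fock_op" where
  "parity = (\<Sum>S\<in>UNIV. (-1) ^ card S *\<^sub>C ketbra (ket S) (ket S))"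

definition fermionic_state :: "'m::{finite,linorder} fock_op \<Rightarrow> bool" where
  "fermionic_state W \<longleftrightarrow> density_operator W \<and> W ** parity = parity ** W"


section \<open>Wedge products\<close>

text \<open>\<open>wedge_ket S T\<close> is $|x\rangle\wedge|y\rangle$ for \<open>x = ket S\<close> and \<open>y = ket T\<close>.\<close>

definition wedge_ket ::
    "'a::{finite,linorder} set \<Rightarrow> 'b::{finite,linorder} set \<Rightarrow> ('a + 'b) fock" where
  "wedge_ket S T =
     create_all (map Inl (sorted_list_of_set S) @ map Inr (sorted_list_of_set T))"

text \<open>Bilinear extension of
  $|x\rangle\langle x'|\wedge|y\rangle\langle y'|=(|x\rangle\wedge|y\rangle)(\langle x'|\wedge\langle y'|)$
  from basis kets; the coefficients of the factors are $\langle x|A|x'\rangle$ and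
  $\langle y|B|y'\rangle$.\<close>

definition op_wedge ::
    "'a::{finite,linorder} fock_op \<Rightarrow> 'b::{finite,linorder} fock_op \<Rightarrow> ('a + 'b) fock_op"
    (infixr "\<and>\<^sub>F" 72) where
  "A \<and>\<^sub>F B = (\<Sum>S\<in>UNIV. \<Sum>S'\<in>UNIV. \<Sum>T\<in>UNIV. \<Sum>T'\<in>UNIV.
     (braket (ket S) (A *v ket S') * braket (ket T) (B *v ket T')) *\<^sub>C
       ketbra (wedge_ket S T) (wedge_ket S' T'))"

lemma matrix_axis: "A *v axis k 1 = (\<chi> i. A $ i $ k)" for A :: "complex^'a^'b"
  by (simp add: matrix_vector_mult_def axis_def vec_eq_iff if_distrib[of "\<lambda>c. _ * c"] cong: if_cong)

lemma creation_axis: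
  "creation j *v axis T 1 = (if j \<in> T then 0 else (-1) ^ card {i \<in> T. i < j} *s axis (insert j T) 1)"
  unfolding creation_def matrix_axis by (auto simp: vec_eq_iff axis_def)

lemma create_all_sorted:
  "sorted js \<Longrightarrow> distinct js \<Longrightarrow> create_all js = axis (set js) 1"
proof (induction js)
  case Nil
  then show ?case by (simp add: create_all_def vacuum_def)
next
  case (Cons j js)
  have "{i \<in> set js. i < j} = {}" using Cons.prems by auto
  moreover have "create_all (j # js) = creation j *v create_all js"
    by (simp add: create_all_def)
  ultimately show ?case using Cons by (simp add: creation_axis del: Collect_empty_eq)
qed

lemma ket_eq_axis: "ket S = axis S 1"
  by (simp add: ket_def create_all_sorted)

lemma wedge_ket_eq_axis: "wedge_ket S T = axis (Inl ` S \<union> Inr ` T) 1"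
proof -
  have "sorted (map Inl (sorted_list_of_set S) @ map Inr (sorted_list_of_set T))"
    by (auto simp: sorted_append sorted_map)
  moreover have "distinct (map Inl (sorted_list_of_set S) @ map Inr (sorted_list_of_set T))"
    by (auto simp: distinct_map)
  ultimately show ?thesis
    by (simp add: wedge_ket_def create_all_sorted)
qed

lemma braket_ketbra_ket:
  "braket (ket S) (ketbra (ket P) (ket Q) *v ket S') = (if S = P \<and> S' = Q then 1 else 0)"
proof -
  have "ketbra (ket P) (ket Q) *v ket S' = (if S' = Q then ket P else 0)"
    unfolding ket_eq_axis matrix_axis
    by (auto simp: ketbra_def vec_eq_iff axis_def)
  moreover have "braket (ket S) v = v $ S" for v
    by (simp add: ket_eq_axis braket_def axis_def if_distrib[of cnj]
        if_distrib[of "\<lambda>c. c * _"] cong: if_cong)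
  ultimately show ?thesis
    by (auto simp: ket_eq_axis axis_def)
qed

lemma sum_if_const:
  "(\<Sum>x\<in>X. if P then f x else 0) = (if P then \<Sum>x\<in>X. f x else 0)"
  by simp

lemma op_wedge_ketbra:
  "ketbra (ket S) (ket S') \<and>\<^sub>F ketbra (ket T) (ket T') = ketbra (wedge_ket S T) (wedge_ket S' T')"
proof -
  have *: "((if P then 1 else 0) * (if Q then 1 else 0)) *\<^sub>C A =
      (if P then if Q then A else 0 else 0)" for P Q and A :: "('a + 'b) fock_op"
    by simp
  have "ketbra (ket S) (ket S') \<and>\<^sub>F ketbra (ket T) (ket T') =
      (\<Sum>P\<in>UNIV. \<Sum>P'\<in>UNIV. \<Sum>Q\<in>UNIV. \<Sum>Q'\<in>UNIV.
        if P = S then if P' = S' then if Q = T then if Q' = T' then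
          ketbra (wedge_ket P Q) (wedge_ket P' Q') else 0 else 0 else 0 else 0)"
    unfolding op_wedge_def braket_ketbra_ket * by (intro sum.cong refl) simp
  also have "\<dots> = ketbra (wedge_ket S T) (wedge_ket S' T')"
    by (simp only: sum_if_const sum.delta finite UNIV_I if_True)
  finally show ?thesis .
qed


section \<open>Identity and flip operators of the parity sectors\<close>

definition I_E :: "('n::{finite,linorder} + 'n) fock_op" where
  "I_E =
     (\<Sum>i\<in>Ev. \<Sum>j\<in>Ev. ketbra (ket i) (ket i) \<and>\<^sub>F ketbra (ket j) (ket j)) +
     (\<Sum>i\<in>Od. \<Sum>j\<in>Od. ketbra (ket i) (ket i) \<and>\<^sub>F ketbra (ket j) (ket j))"

definition I_O :: "('n::{finite,linorder} + 'n) fock_op" where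
  "I_O =
     (\<Sum>i\<in>Ev. \<Sum>j\<in>Od. ketbra (ket i) (ket i) \<and>\<^sub>F ketbra (ket j) (ket j)) +
     (\<Sum>i\<in>Od. \<Sum>j\<in>Ev. ketbra (ket i) (ket i) \<and>\<^sub>F ketbra (ket j) (ket j))"

definition H_E :: "('n::{finite,linorder} + 'n) fock_op" where
  "H_E =
     (\<Sum>i\<in>Ev. \<Sum>j\<in>Ev. ketbra (ket i) (ket j) \<and>\<^sub>F ketbra (ket j) (ket i)) +
     (\<Sum>i\<in>Od. \<Sum>j\<in>Od. ketbra (ket i) (ket j) \<and>\<^sub>F ketbra (ket j) (ket i))"

definition H_O :: "('n::{finite,linorder} + 'n) fock_op" where
  "H_O =
     (\<Sum>i\<in>Ev. \<Sum>j\<in>Od. ketbra (ket i) (ket j) \<and>\<^sub>F ketbra (ket j) (ket i)) +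
     (\<Sum>i\<in>Od. \<Sum>j\<in>Ev. ketbra (ket i) (ket j) \<and>\<^sub>F ketbra (ket j) (ket i))"

end

theory Submission
  imports Defs
begin

text \<open>In the basis of wedge kets, indexed by \<open>S <+> T\<close>, \<open>U \<and>\<^sub>F U\<close> is an ordinary tensor square
  without fermionic signs, and the hypothesis says that \<open>W\<close> commutes with it. Diagonal unitaries with
  a single phase \<open>\<i>\<close> annihilate every entry of \<open>W\<close> between pairs \<open>(S, T)\<close> and \<open>(S', T')\<close> that are
  not equal up to a swap. Permutations of the basis that preserve or exchange the parities make the
  remaining entries depend only on whether \<open>S = T\<close> and whether \<open>S\<close> and \<open>T\<close> have the same parity.
  Finally, a reflection in the plane of two kets of equal parity forces the entry for \<open>S = T\<close> to be
  the sum of the diagonal and the exchange entry for \<open>S \<noteq> T\<close>.\<close>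

section \<open>Entries in the basis of wedge kets\<close>

lemma Plus_eq_iff: "A <+> B = C <+> D \<longleftrightarrow> A = C \<and> B = D"
  by (auto simp: Plus_def)

lemma Plus_vimage: "Inl -` X <+> Inr -` X = X"
proof (rule set_eqI)
  show "x \<in> Inl -` X <+> Inr -` X \<longleftrightarrow> x \<in> X" for x
    by (cases x) auto
qed

text \<open>A set of modes of the composite system splits uniquely into its left and right parts.
  Sums over the composite basis thus become double sums over pairs of basis kets.\<close>

lemma bij_Plus: "bij (\<lambda>(A :: 'a set, B :: 'b set). A <+> B)"
  by (rule bij_betw_byWitness[where f' = "\<lambda>X. (Inl -` X, Inr -` X)"])
    (auto simp: Plus_vimage)

lemma sum_UNIV_Plus:
  fixes f :: "('a::finite + 'b::finite) set \<Rightarrow> 'c::comm_monoid_add"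
  shows "sum f UNIV = (\<Sum>A\<in>UNIV. \<Sum>B\<in>UNIV. f (A <+> B))"
proof -
  have "sum f UNIV = (\<Sum>(A, B)\<in>UNIV. f (A <+> B))"
    using sum.reindex_bij_betw[OF bij_Plus, of f] by (simp add: case_prod_beta)
  then show ?thesis
    by (simp add: sum.cartesian_product)
qed

lemma matrix_eqI_Plus:
  fixes A B :: "('a::{finite,linorder} + 'b::{finite,linorder}) fock_op"
  assumes "\<And>S T S' T'. A $ (S <+> T) $ (S' <+> T') = B $ (S <+> T) $ (S' <+> T')"
  shows "A = B"
  unfolding vec_eq_iff by (metis assms Plus_vimage)

lemma cscale_nth [simp]: "(c *\<^sub>C A) $ i $ j = c * A $ i $ j"
  by (simp add: cscale_def)

lemma ketbra_ket_nth: "ketbra (ket P) (ket Q) $ S $ T = (if P = S \<and> Q = T then 1 else 0)"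
  by (auto simp: ketbra_def ket_eq_axis axis_def)

lemma braket_ket_mult: "braket (ket S) (A *v ket T) = A $ S $ T"
proof -
  have "braket (ket S) v = v $ S" for v
    by (simp add: ket_eq_axis braket_def axis_def if_distrib[of cnj]
        if_distrib[of "\<lambda>c. c * _"] cong: if_cong)
  then show ?thesis
    by (simp add: ket_eq_axis matrix_axis)
qed

text \<open>All left modes precede all right modes, so a wedge ket is the basis vector at
  \<open>S <+> T\<close> with sign +1. Entries therefore multiply as in a Kronecker product.\<close>

lemma op_wedge_nth:
  "(A \<and>\<^sub>F B) $ (S <+> T) $ (S' <+> T') = A $ S $ S' * B $ T $ T'"
proof -
  have *: "ketbra (wedge_ket P Q) (wedge_ket P' Q') $ (S <+> T) $ (S' <+> T') =
      (if P = S then if P' = S' then if Q = T then if Q' = T' then 1 else 0 else 0 else 0 else 0)"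
    for P P' Q Q'
    by (auto simp: ketbra_def wedge_ket_eq_axis axis_def Plus_eq_iff simp flip: Plus_def)
  have "(A \<and>\<^sub>F B) $ (S <+> T) $ (S' <+> T') =
     (\<Sum>P\<in>UNIV. \<Sum>P'\<in>UNIV. \<Sum>Q\<in>UNIV. \<Sum>Q'\<in>UNIV.
       if P = S then if P' = S' then if Q = T then if Q' = T' then A $ P $ P' * B $ Q $ Q'
       else 0 else 0 else 0 else 0)"
    unfolding op_wedge_def sum_component cscale_nth * braket_ket_mult
    by (intro sum.cong refl) simp
  also have "\<dots> = A $ S $ S' * B $ T $ T'"
    by (simp only: sum_if_const sum.delta finite UNIV_I if_True)
  finally show ?thesis .
qed

lemma mult_nth_Plus:
  fixes A B :: "('a::{finite,linorder} + 'b::{finite,linorder}) fock_op"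
  shows "(A ** B) $ X $ Y = (\<Sum>P\<in>UNIV. \<Sum>Q\<in>UNIV. A $ X $ (P <+> Q) * B $ (P <+> Q) $ Y)"
  by (simp add: matrix_matrix_mult_def sum_UNIV_Plus)

lemma op_wedge_mult: "(A \<and>\<^sub>F B) ** (C \<and>\<^sub>F D) = (A ** C) \<and>\<^sub>F (B ** D)"
proof (rule matrix_eqI_Plus)
  show "((A \<and>\<^sub>F B) ** (C \<and>\<^sub>F D)) $ (S <+> T) $ (S' <+> T') =
      ((A ** C) \<and>\<^sub>F (B ** D)) $ (S <+> T) $ (S' <+> T')" for S T S' T'
    unfolding mult_nth_Plus op_wedge_nth
    by (simp add: matrix_matrix_mult_def sum_product mult_ac)
qed

lemma op_wedge_mat_1: "mat 1 \<and>\<^sub>F mat 1 = mat 1"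
  by (rule matrix_eqI_Plus) (simp add: op_wedge_nth mat_def Plus_eq_iff)

section \<open>Entries of the four invariant operators\<close>

lemma sum_diagonal_nth:
  "(\<Sum>i\<in>X. \<Sum>j\<in>Y. ketbra (ket i) (ket i) \<and>\<^sub>F ketbra (ket j) (ket j)) $ (S <+> T) $ (S' <+> T') =
     (if S \<in> X \<and> T \<in> Y \<and> S' = S \<and> T' = T then 1 else 0)"
proof -
  have "(\<Sum>i\<in>X. \<Sum>j\<in>Y. ketbra (ket i) (ket i) \<and>\<^sub>F ketbra (ket j) (ket j)) $ (S <+> T) $ (S' <+> T') =
     (\<Sum>i\<in>X. \<Sum>j\<in>Y. if i = S then if j = T then if S' = S \<and> T' = T then 1 else 0 else 0 else 0)"
    unfolding sum_component op_wedge_nth ketbra_ket_nth by (intro sum.cong refl) auto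
  also have "\<dots> = (if S \<in> X \<and> T \<in> Y \<and> S' = S \<and> T' = T then 1 else 0)"
    by (simp only: sum_if_const sum.delta finite) auto
  finally show ?thesis .
qed

lemma sum_exchange_nth:
  "(\<Sum>i\<in>X. \<Sum>j\<in>Y. ketbra (ket i) (ket j) \<and>\<^sub>F ketbra (ket j) (ket i)) $ (S <+> T) $ (S' <+> T') =
     (if S \<in> X \<and> T \<in> Y \<and> S' = T \<and> T' = S then 1 else 0)"
proof -
  have "(\<Sum>i\<in>X. \<Sum>j\<in>Y. ketbra (ket i) (ket j) \<and>\<^sub>F ketbra (ket j) (ket i)) $ (S <+> T) $ (S' <+> T') =
     (\<Sum>i\<in>X. \<Sum>j\<in>Y. if i = S then if j = T then if S' = T \<and> T' = S then 1 else 0 else 0 else 0)"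
    unfolding sum_component op_wedge_nth ketbra_ket_nth by (intro sum.cong refl) auto
  also have "\<dots> = (if S \<in> X \<and> T \<in> Y \<and> S' = T \<and> T' = S then 1 else 0)"
    by (simp only: sum_if_const sum.delta finite) auto
  finally show ?thesis .
qed

lemma I_E_nth:
  "I_E $ (S <+> T) $ (S' <+> T') =
     (if S' = S \<and> T' = T \<and> even (card S) = even (card T) then 1 else 0)"
  unfolding I_E_def vector_add_component sum_diagonal_nth by (auto simp: Ev_def Od_def)

lemma I_O_nth:
  "I_O $ (S <+> T) $ (S' <+> T') =
     (if S' = S \<and> T' = T \<and> even (card S) \<noteq> even (card T) then 1 else 0)"
  unfolding I_O_def vector_add_component sum_diagonal_nth by (auto simp: Ev_def Od_def)

lemma H_E_nth:
  "H_E $ (S <+> T) $ (S' <+> T') =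
     (if S' = T \<and> T' = S \<and> even (card S) = even (card T) then 1 else 0)"
  unfolding H_E_def vector_add_component sum_exchange_nth by (auto simp: Ev_def Od_def)

lemma H_O_nth:
  "H_O $ (S <+> T) $ (S' <+> T') =
     (if S' = T \<and> T' = S \<and> even (card S) \<noteq> even (card T) then 1 else 0)"
  unfolding H_O_def vector_add_component sum_exchange_nth by (auto simp: Ev_def Od_def)


section \<open>Block-diagonal and anti-block-diagonal unitaries\<close>

lemma fock_op_expansion:
  fixes A :: "'n::{finite,linorder} fock_op"
  shows "A = (\<Sum>S\<in>UNIV. \<Sum>T\<in>UNIV. A $ S $ T *\<^sub>C ketbra (ket S) (ket T))"
proof -
  have "(\<Sum>S\<in>UNIV. \<Sum>T\<in>UNIV. A $ S $ T *\<^sub>C ketbra (ket S) (ket T)) $ P $ Q =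
     (\<Sum>S\<in>UNIV. \<Sum>T\<in>UNIV. if S = P then if T = Q then A $ S $ T else 0 else 0)" for P Q
    unfolding sum_component cscale_nth ketbra_ket_nth by (intro sum.cong refl) simp
  then show ?thesis
    by (simp add: vec_eq_iff sum_if_const)
qed

text \<open>In the expansion into matrix units, the units of mixed parity have coefficient zero and
  all others are generators of the span.\<close>

lemma block_diagonalI:
  fixes A :: "'n::{finite,linorder} fock_op"
  assumes "\<And>S T. even (card S) \<noteq> even (card T) \<Longrightarrow> A $ S $ T = 0"
  shows "block_diagonal A"
  unfolding block_diagonal_def
proof (subst fock_op_expansion[of A], intro cmat.span_sum)
  fix S T :: "'n set"
  let ?B = "{ketbra (ket S) (ket T) |S T :: 'n set. S \<in> Ev \<and> T \<in> Ev} \<union>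
      {ketbra (ket S) (ket T) |S T. S \<in> Od \<and> T \<in> Od}"
  show "A $ S $ T *\<^sub>C ketbra (ket S) (ket T) \<in> cmat.span ?B"
  proof (cases "even (card S) = even (card T)")
    case True
    then have "ketbra (ket S) (ket T) \<in> ?B"
      by (auto simp: Ev_def Od_def)
    then show ?thesis
      by (intro cmat.span_scale cmat.span_base)
  qed (simp add: assms cmat.span_zero)
qed

lemma anti_block_diagonalI:
  fixes A :: "'n::{finite,linorder} fock_op"
  assumes "\<And>S T. even (card S) = even (card T) \<Longrightarrow> A $ S $ T = 0"
  shows "anti_block_diagonal A"
  unfolding anti_block_diagonal_def
proof (subst fock_op_expansion[of A], intro cmat.span_sum)
  fix S T :: "'n set"
  let ?B = "{ketbra (ket S) (ket T) |S T :: 'n set. S \<in> Ev \<and> T \<in> Od} \<union>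
      {ketbra (ket S) (ket T) |S T. S \<in> Od \<and> T \<in> Ev}"
  show "A $ S $ T *\<^sub>C ketbra (ket S) (ket T) \<in> cmat.span ?B"
  proof (cases "even (card S) = even (card T)")
    case False
    then have "ketbra (ket S) (ket T) \<in> ?B"
      by (auto simp: Ev_def Od_def)
    then show ?thesis
      by (intro cmat.span_scale cmat.span_base)
  qed (simp add: assms cmat.span_zero)
qed

lemma unitaryI: "dagger U ** U = mat 1 \<Longrightarrow> unitary U"
  by (simp add: unitary_def matrix_left_right_inverse)

text \<open>Sends the ket of \<open>T\<close> to \<open>u T\<close> times the ket of
  \<open>p T\<close>. The case \<open>p = id\<close> gives diagonal phases, constant
  \<open>u = 1\<close> gives basis permutations.\<close>

definition monomial :: "('n \<Rightarrow> 'n) \<Rightarrow> ('n \<Rightarrow> complex) \<Rightarrow> complex^'n^'n" where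
  "monomial p u = (\<chi> S T. if S = p T then u T else 0)"

lemma unitary_monomial:
  assumes "inj p" and "\<And>x. cmod (u x) = 1"
  shows "unitary (monomial p u)"
proof (rule unitaryI)
  have "cnj (u x) * u x = 1" for x
    using assms(2)[of x] by (simp add: mult.commute flip: complex_norm_square)
  then show "dagger (monomial p u) ** monomial p u = mat 1"
    by (auto simp: vec_eq_iff matrix_matrix_mult_def dagger_def monomial_def mat_def
        if_distrib[of cnj] if_distrib[of "\<lambda>c. c * _"] inj_eq[OF assms(1)] cong: if_cong)
qed

text \<open>The rational entries come from $3^2 + 4^2 = 5^2$; all that matters is that the reflection
  mixes \<open>P\<close> and \<open>Q\<close>.\<close>

definition plane_reflection :: "'n \<Rightarrow> 'n \<Rightarrow> complex^'n^'n" where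
  "plane_reflection P Q = (\<chi> S T.
     if S \<in> {P, Q} \<and> T \<in> {P, Q} then (if S \<noteq> T then 4 / 5 else if S = P then 3 / 5 else - 3 / 5)
     else if S = T then 1 else 0)"

lemma plane_reflection_nth:
  assumes "P \<noteq> Q"
  shows "plane_reflection P Q $ P $ P = 3 / 5" "plane_reflection P Q $ Q $ Q = - 3 / 5"
    "plane_reflection P Q $ P $ Q = 4 / 5" "plane_reflection P Q $ Q $ P = 4 / 5"
  using assms by (simp_all add: plane_reflection_def)

lemma plane_reflection_nth_off:
  assumes "S \<notin> {P, Q} \<or> T \<notin> {P, Q}"
  shows "plane_reflection P Q $ S $ T = (if S = T then 1 else 0)"
proof -
  have "\<not> (S \<in> {P, Q} \<and> T \<in> {P, Q})"
    using assms by blast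
  then show ?thesis
    by (simp only: plane_reflection_def vec_lambda_beta if_False)
qed

lemma sum_eq_pair:
  fixes f :: "'a::finite \<Rightarrow> 'b::comm_monoid_add"
  assumes "P \<noteq> Q" and "\<And>x. x \<noteq> P \<Longrightarrow> x \<noteq> Q \<Longrightarrow> f x = 0"
  shows "sum f UNIV = f P + f Q"
proof -
  have "sum f UNIV = sum f {P, Q}"
    by (rule sum.mono_neutral_right) (use assms(2) in auto)
  then show ?thesis
    using assms(1) by simp
qed

lemma unitary_plane_reflection:
  fixes P Q :: "'n::finite"
  assumes "P \<noteq> Q"
  shows "unitary (plane_reflection P Q)"
proof (rule unitaryI)
  let ?U = "plane_reflection P Q"
  note U = plane_reflection_nth[OF assms]
  note off = plane_reflection_nth_off[of _ P Q]
  have "dagger ?U $ S $ T = ?U $ S $ T" for S T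
  proof (cases "S \<in> {P, Q} \<and> T \<in> {P, Q}")
    case True
    then show ?thesis
      by (elim conjE insertE emptyE) (simp_all add: dagger_def U)
  next
    case False
    then have "?U $ S $ T = (if S = T then 1 else 0)" "?U $ T $ S = (if S = T then 1 else 0)"
      using off[of S T] off[of T S] by (blast, metis)
    then show ?thesis
      by (simp add: dagger_def)
  qed
  then have "dagger ?U = ?U"
    by (simp add: vec_eq_iff)
  \<comment> \<open>The matrix is self-adjoint, so its square remains to be computed. Rows
    \<open>P\<close> and \<open>Q\<close> have at most two nonzero entries; every other row is that
    of the identity.\<close>
  moreover have "(\<Sum>R\<in>UNIV. ?U $ S $ R * ?U $ R $ T) = (if S = T then 1 else 0)" for S T
  proof (cases "S \<in> {P, Q}")
    case True
    then have "(\<Sum>R\<in>UNIV. ?U $ S $ R * ?U $ R $ T) =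
        ?U $ S $ P * ?U $ P $ T + ?U $ S $ Q * ?U $ Q $ T"
      by (intro sum_eq_pair assms) (auto simp: off)
    also have "\<dots> = (if S = T then 1 else 0)"
    proof (cases "T \<in> {P, Q}")
      case True
      with \<open>S \<in> {P, Q}\<close> show ?thesis
        using assms by (elim insertE emptyE) (simp_all add: U)
    next
      case False
      with \<open>S \<in> {P, Q}\<close> show ?thesis
        by (auto simp: off)
    qed
    finally show ?thesis .
  next
    case False
    then have "(\<Sum>R\<in>UNIV. ?U $ S $ R * ?U $ R $ T) = (\<Sum>R\<in>UNIV. if R = S then ?U $ R $ T else 0)"
      by (intro sum.cong) (simp_all add: off)
    then show ?thesis
      using False by (simp add: off)
  qed
  ultimately show "dagger ?U ** ?U = mat 1"
    by (simp add: vec_eq_iff matrix_matrix_mult_def mat_def)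
qed

text \<open>Toggling one mode changes the particle number by one. This involution supplies the
  permutation that exchanges the parities.\<close>

lemma card_flip_parity:
  fixes m :: "'n::finite"
  shows "even (card (if m \<in> S then S - {m} else insert m S)) \<longleftrightarrow> odd (card S)"
  by (auto simp: card_Diff_singleton_if card_gt_0_iff intro: ccontr)

text \<open>Transitivity of the parity-respecting permutations on the pairs of each of the three kinds.\<close>

lemma ex_permutation_pair:
  fixes S T S' T' :: "'n::finite set"
  assumes eq: "S = T \<longleftrightarrow> S' = T'"
    and par: "even (card S) = even (card T) \<longleftrightarrow> even (card S') = even (card T')"
  obtains p where "inj p" "p S = S'" "p T = T'"
    "(\<forall>R. even (card (p R)) = even (card R)) \<or> (\<forall>R. even (card (p R)) \<noteq> even (card R))"
proof -
  have same: "\<exists>p. inj p \<and> p S = S' \<and> p T = T' \<and> (\<forall>R. even (card (p R)) = even (card R))"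
    if "S = T \<longleftrightarrow> S' = T'" and "even (card S) = even (card S')"
      and "even (card T) = even (card T')" for S T :: "'n set"
  proof -
    \<comment> \<open>The first transposition takes \<open>S\<close> to \<open>S'\<close>, the
      second takes the image of \<open>T\<close> to \<open>T'\<close>. The second fixes
      \<open>S'\<close>: if \<open>S\<close> and \<open>T\<close> differ, it moves neither of its
      arguments onto or off \<open>S'\<close>; if they agree, it is trivial.\<close>
    define p where "p = Transposition.transpose (Transposition.transpose S S' T) T' \<circ> Transposition.transpose S S'"
    have par1: "even (card (Transposition.transpose A B R)) = even (card R)"
      if "even (card A) = even (card B)" for A B R :: "'n set"
      using that by (auto simp: Transposition.transpose_def)
    have "inj p"
      unfolding p_def by (intro inj_compose) simp_all
    moreover have "p S = S'" "p T = T'"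
      using that(1) by (auto simp: p_def Transposition.transpose_def)
    moreover have "even (card (p R)) = even (card R)" for R
      unfolding p_def comp_def using that(2,3) by (simp add: par1)
    ultimately show ?thesis
      by blast
  qed
  show thesis
  proof (cases "even (card S) = even (card S')")
    case True
    then show thesis
      using same[OF eq] par that by blast
  next
    case False
    \<comment> \<open>By \<open>par\<close>, \<open>T\<close> and \<open>T'\<close> differ in parity
      as well, so toggling an arbitrary mode first reduces to the case of equal parities.\<close>
    obtain m :: 'n where True
      by simp
    define f where "f R = (if m \<in> R then R - {m} else insert m R)" for R
    have f: "even (card (f R)) \<longleftrightarrow> odd (card R)" for R
      unfolding f_def by (rule card_flip_parity)
    have "inj f"
      by (rule inj_on_inverseI[where g = f]) (auto simp: f_def)
    obtain p where "inj p" "p (f S) = S'" "p (f T) = T'" "\<forall>R. even (card (p R)) = even (card R)"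
      using same[of "f S" "f T"] eq par False f inj_eq[OF \<open>inj f\<close>] by metis
    then show thesis
      using that[of "p \<circ> f"] \<open>inj f\<close> f by (simp add: inj_compose)
  qed
qed


section \<open>Operators commuting with the tensor squares\<close>

lemma commute_if_invariant:
  fixes U :: "'n::{finite,linorder} fock_op"
  assumes "unitary U" and "(U \<and>\<^sub>F U) ** W ** (dagger U \<and>\<^sub>F dagger U) = W"
  shows "(U \<and>\<^sub>F U) ** W = W ** (U \<and>\<^sub>F U)"
proof -
  have "W ** (U \<and>\<^sub>F U) = ((U \<and>\<^sub>F U) ** W ** (dagger U \<and>\<^sub>F dagger U)) ** (U \<and>\<^sub>F U)"
    using assms(2) by simp
  also have "\<dots> = (U \<and>\<^sub>F U) ** W ** ((dagger U \<and>\<^sub>F dagger U) ** (U \<and>\<^sub>F U))"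
    by (simp add: matrix_mul_assoc)
  also have "\<dots> = (U \<and>\<^sub>F U) ** W"
    using assms(1) by (simp add: op_wedge_mult unitary_def op_wedge_mat_1)
  finally show ?thesis
    by simp
qed

text \<open>Compares both products at row \<open>p S <+> p T\<close> and column
  \<open>S' <+> T'\<close>. One term survives on each side; on the left it is singled out by
  injectivity of \<open>p\<close>.\<close>

lemma commute_monomial_nth:
  fixes W :: "('n::{finite,linorder} + 'n) fock_op"
  assumes "inj p"
    and "(monomial p u \<and>\<^sub>F monomial p u) ** W = W ** (monomial p u \<and>\<^sub>F monomial p u)"
  shows "u S * u T * W $ (S <+> T) $ (S' <+> T') =
     W $ (p S <+> p T) $ (p S' <+> p T') * (u S' * u T')"
proof -
  have "((monomial p u \<and>\<^sub>F monomial p u) ** W) $ (p S <+> p T) $ (S' <+> T') =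
     (\<Sum>P\<in>UNIV. \<Sum>Q\<in>UNIV.
       if P = S then if Q = T then u P * u Q * W $ (P <+> Q) $ (S' <+> T') else 0 else 0)"
    unfolding mult_nth_Plus op_wedge_nth
    by (intro sum.cong refl) (auto simp: monomial_def inj_eq[OF assms(1)])
  moreover have "(W ** (monomial p u \<and>\<^sub>F monomial p u)) $ (p S <+> p T) $ (S' <+> T') =
     (\<Sum>P\<in>UNIV. \<Sum>Q\<in>UNIV.
       if P = p S' then if Q = p T' then W $ (p S <+> p T) $ (P <+> Q) * (u S' * u T') else 0 else 0)"
    unfolding mult_nth_Plus op_wedge_nth
    by (intro sum.cong refl) (auto simp: monomial_def)
  ultimately show ?thesis
    using assms(2) by (simp add: sum_if_const)
qed

theorem lemma4:
  fixes W :: "('n::{finite,linorder} + 'n) fock_op"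
  assumes "fermionic_state W"
    and "\<And>U :: 'n fock_op. unitary U \<Longrightarrow> block_diagonal U \<or> anti_block_diagonal U \<Longrightarrow>
           (U \<and>\<^sub>F U) ** W ** (dagger U \<and>\<^sub>F dagger U) = W"
  shows "\<exists>aE aO bE bO :: complex.
           W = aE *\<^sub>C I_E + aO *\<^sub>C I_O + bE *\<^sub>C H_E + bO *\<^sub>C H_O"
proof -
  define w where "w S T S' T' = W $ (S <+> T) $ (S' <+> T')" for S T S' T' :: "'n set"
  have comm: "(U \<and>\<^sub>F U) ** W = W ** (U \<and>\<^sub>F U)"
    if "unitary U" "block_diagonal U \<or> anti_block_diagonal U" for U :: "'n fock_op"
    using that by (intro commute_if_invariant assms(2))

  \<comment> \<open>Symmetry of the entries under basis permutations\<close>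
  have perm: "w S T S' T' = w (p S) (p T) (p S') (p T')"
    if "inj p"
      and par: "(\<forall>R. even (card (p R)) = even (card R)) \<or> (\<forall>R. even (card (p R)) \<noteq> even (card R))"
    for p S T S' T'
  proof -
    let ?U = "monomial p (\<lambda>_. 1) :: 'n fock_op"
    have "block_diagonal ?U \<or> anti_block_diagonal ?U"
      using par
    proof
      assume "\<forall>R. even (card (p R)) = even (card R)"
      then have "block_diagonal ?U"
        by (intro block_diagonalI) (auto simp: monomial_def)
      then show ?thesis ..
    next
      assume "\<forall>R. even (card (p R)) \<noteq> even (card R)"
      then have "anti_block_diagonal ?U"
        by (intro anti_block_diagonalI) (auto simp: monomial_def)
      then show ?thesis ..
    qed
    moreover have "unitary ?U"
      using \<open>inj p\<close> by (rule unitary_monomial) simp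
    ultimately have "(?U \<and>\<^sub>F ?U) ** W = W ** (?U \<and>\<^sub>F ?U)"
      by (intro comm)
    from commute_monomial_nth[OF \<open>inj p\<close> this, of S T S' T'] show ?thesis
      by (simp add: w_def)
  qed
  have transit: "w S T S T = w P Q P Q \<and> w S T T S = w P Q Q P"
    if eq: "S = T \<longleftrightarrow> P = Q"
      and par: "even (card S) = even (card T) \<longleftrightarrow> even (card P) = even (card Q)" for S T P Q
  proof -
    obtain p where "inj p" "p S = P" "p T = Q"
      "(\<forall>R. even (card (p R)) = even (card R)) \<or> (\<forall>R. even (card (p R)) \<noteq> even (card R))"
      using ex_permutation_pair[OF eq par] .
    then show ?thesis
      using perm[of p S T S T] perm[of p S T T S] by simp
  qed

  \<comment> \<open>Vanishing entries\<close>
  have support: "S' = S \<and> T' = T \<or> S' = T \<and> T' = S" if "w S T S' T' \<noteq> 0" for S T S' T'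
  proof -
    \<comment> \<open>The product of phases is \<open>\<i>\<close> to the number of occurrences of
      \<open>x\<close> in the pair. Since 1, \<open>\<i>\<close> and -1 are distinct, it determines
      whether \<open>x\<close> occurs zero, one or two times; a phase -1 would confuse zero with
      two.\<close>
    define u where "u x = (\<lambda>R. if R = x then \<i> else 1)" for x :: "'n set"
    have u: "u x S * u x T = u x S' * u x T'" for x
    proof -
      let ?U = "monomial id (u x) :: 'n fock_op"
      have "block_diagonal ?U"
        by (intro block_diagonalI) (auto simp: monomial_def)
      moreover have "unitary ?U"
        by (rule unitary_monomial) (simp_all add: u_def)
      ultimately have "(?U \<and>\<^sub>F ?U) ** W = W ** (?U \<and>\<^sub>F ?U)"
        by (intro comm disjI1)
      from commute_monomial_nth[OF inj_on_id this, of S T S' T'] that show ?thesis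
        by (simp add: w_def)
    qed
    have "\<i> \<noteq> -1" "-1 \<noteq> \<i>"
      by (simp_all add: complex_eq_iff)
    then show ?thesis
      using u[of S] u[of T] by (auto simp: u_def split: if_splits)
  qed

  \<comment> \<open>Relation between the entries within one parity\<close>
  have equal_pair: "w R R R R = w P Q P Q + w P Q Q P"
    if "P \<noteq> Q" and par: "even (card P) = even (card Q)" for P Q R
  proof -
    let ?U = "plane_reflection P Q"
    have left: "w A B P Q = 0" if "\<not> (A = P \<and> B = Q)" "\<not> (A = Q \<and> B = P)" for A B
      using support[of A B P Q] that by metis
    have right: "w P P A B = 0" if "\<not> (A = P \<and> B = P)" for A B
      using support[of P P A B] that by metis
    \<comment> \<open>The product of a diagonal entry 3/5 and an off-diagonal entry 4/5 of the
      reflection. It is the common factor of all surviving terms at row \<open>P <+> P\<close> and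
      column \<open>P <+> Q\<close>, and cancels.\<close>
    define c :: complex where "c = 12 / 25"
    have "c \<noteq> 0"
      by (simp add: c_def)
    note U = plane_reflection_nth[OF \<open>P \<noteq> Q\<close>]
    have "block_diagonal ?U"
    proof (rule block_diagonalI)
      fix S T :: "'n set"
      assume "even (card S) \<noteq> even (card T)"
      then have "S \<notin> {P, Q} \<or> T \<notin> {P, Q}" "S \<noteq> T"
        using par by auto
      then show "?U $ S $ T = 0"
        by (simp add: plane_reflection_nth_off)
    qed
    then have "((?U \<and>\<^sub>F ?U) ** W) $ (P <+> P) $ (P <+> Q) = (W ** (?U \<and>\<^sub>F ?U)) $ (P <+> P) $ (P <+> Q)"
      using comm unitary_plane_reflection[OF \<open>P \<noteq> Q\<close>] by simp
    moreover have "((?U \<and>\<^sub>F ?U) ** W) $ (P <+> P) $ (P <+> Q) =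
        (\<Sum>A\<in>UNIV. \<Sum>B\<in>UNIV. (if A = P then if B = Q then c * w P Q P Q else 0 else 0) +
           (if A = Q then if B = P then c * w Q P P Q else 0 else 0))"
      unfolding mult_nth_Plus op_wedge_nth w_def[symmetric]
    proof (intro sum.cong refl)
      fix A B
      consider "A = P" "B = Q" | "A = Q" "B = P" | "\<not> (A = P \<and> B = Q)" "\<not> (A = Q \<and> B = P)"
        by blast
      then show "?U $ P $ A * ?U $ P $ B * w A B P Q =
          (if A = P then if B = Q then c * w P Q P Q else 0 else 0) +
          (if A = Q then if B = P then c * w Q P P Q else 0 else 0)"
        by cases (use \<open>P \<noteq> Q\<close> in \<open>simp_all add: U left c_def\<close>)
    qed
    moreover have "(W ** (?U \<and>\<^sub>F ?U)) $ (P <+> P) $ (P <+> Q) =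
        (\<Sum>A\<in>UNIV. \<Sum>B\<in>UNIV. if A = P then if B = P then c * w P P P P else 0 else 0)"
      unfolding mult_nth_Plus op_wedge_nth w_def[symmetric]
      by (intro sum.cong refl) (simp add: U right c_def)
    ultimately have "c * w P P P P = c * w P Q P Q + c * w Q P P Q"
      by (simp add: sum.distrib sum_if_const)
    then have "w P P P P = w P Q P Q + w Q P P Q"
      using \<open>c \<noteq> 0\<close> by (simp flip: distrib_left)
    moreover have "w Q P P Q = w P Q Q P"
      using transit[of Q P P Q] \<open>P \<noteq> Q\<close> par by simp
    ultimately show ?thesis
      using transit[of R R P P] by simp
  qed

  \<comment> \<open>The four coefficients\<close>
  obtain aE bE where
    E: "\<And>S. w S S S S = aE + bE"
      "\<And>S T. S \<noteq> T \<Longrightarrow> even (card S) = even (card T) \<Longrightarrow> w S T S T = aE \<and> w S T T S = bE"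
  proof (cases "\<exists>P Q :: 'n set. P \<noteq> Q \<and> even (card P) = even (card Q)")
    case True
    then obtain P Q :: "'n set" where PQ: "P \<noteq> Q" "even (card P) = even (card Q)"
      by blast
    show thesis
    proof (rule that)
      show "w S S S S = w P Q P Q + w P Q Q P" for S
        by (rule equal_pair[OF PQ])
      show "w S T S T = w P Q P Q \<and> w S T T S = w P Q Q P"
        if "S \<noteq> T" "even (card S) = even (card T)" for S T
        by (rule transit) (use that PQ in simp_all)
    qed
  next
    \<comment> \<open>This is the case of a single mode, where each parity has only one ket. Only
      the sum \<open>aE + bE\<close> is then determined, and \<open>bE = 0\<close> is one
      choice.\<close>
    case False
    show thesis
    proof (rule that)
      show "w S S S S = w {} {} {} {} + 0" for S
        using transit[of S S "{}" "{}"] by simp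
    qed (use False in blast)
  qed
  obtain aO bO where
    O: "\<And>S T. even (card S) \<noteq> even (card T) \<Longrightarrow> w S T S T = aO \<and> w S T T S = bO"
  proof -
    \<comment> \<open>A mode exists because types are nonempty; \<open>{}\<close> and
      \<open>{m}\<close> serve as the reference pair of opposite parity.\<close>
    obtain m :: 'n where True
      by simp
    show thesis
    proof (rule that)
      show "w S T S T = w {} {m} {} {m} \<and> w S T T S = w {} {m} {m} {}"
        if "even (card S) \<noteq> even (card T)" for S T
        by (rule transit) (use that in auto)
    qed
  qed
  have "W = aE *\<^sub>C I_E + aO *\<^sub>C I_O + bE *\<^sub>C H_E + bO *\<^sub>C H_O"
  proof (rule matrix_eqI_Plus)
    fix S T S' T' :: "'n set"
    show "W $ (S <+> T) $ (S' <+> T') =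
      (aE *\<^sub>C I_E + aO *\<^sub>C I_O + bE *\<^sub>C H_E + bO *\<^sub>C H_O) $ (S <+> T) $ (S' <+> T')"
      (is "_ = ?V $ _ $ _")
    proof -
      \<comment> \<open>Stated for Boolean variables, as the simplifier loops on the equations between sets.\<close>
      have bool: "aE * (if p \<and> q \<and> e = e' then 1 else 0) + aO * (if p \<and> q \<and> e \<noteq> e' then 1 else 0) +
          bE * (if r \<and> s \<and> e = e' then 1 else 0) + bO * (if r \<and> s \<and> e \<noteq> e' then 1 else 0) =
          (if p \<and> q then if e = e' then aE else aO else 0) +
          (if r \<and> s then if e = e' then bE else bO else 0)" for p q r s e e' :: bool
        by (cases p; cases q; cases r; cases s; cases "e = e'") simp_all
      have V: "?V $ (S <+> T) $ (S' <+> T') =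
          (if S' = S \<and> T' = T then if even (card S) = even (card T) then aE else aO else 0) +
          (if S' = T \<and> T' = S then if even (card S) = even (card T) then bE else bO else 0)"
        unfolding vector_add_component cscale_nth I_E_nth I_O_nth H_E_nth H_O_nth by (rule bool)
      \<comment> \<open>The case \<open>S = T\<close> stands apart because the identity and the flip
        both contribute there, giving \<open>aE + bE\<close>.\<close>
      consider "w S T S' T' = 0" "\<not> (S' = S \<and> T' = T)" "\<not> (S' = T \<and> T' = S)"
        | "S = T" "S' = S" "T' = S" | "S \<noteq> T" "S' = S" "T' = T" | "S \<noteq> T" "S' = T" "T' = S"
        using support[of S T S' T'] by metis
      then have "w S T S' T' = ?V $ (S <+> T) $ (S' <+> T')"
      proof cases
        case 1
        then show ?thesis
          unfolding V by (simp only: if_False add_0)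
      qed (unfold V, use E(1)[of S] E(2)[of S T] O[of S T] in simp_all)
      then show ?thesis
        unfolding w_def .
    qed
  qed
  then show ?thesis
    by blast
qed

end
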